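(* Let $\mathbb{X}$ be a set with a symmetric neighbouring relation $\simeq$, let $f : \mathbb{X} \to \mathbb{R}^d$ have global $L_2$ sensitivity $\Delta = \sup_{x \simeq x'} \|f(x) - f(x')\|$ with $0 < \Delta < \infty$, and let $\delta \in (0,1]$. Then the Gaussian output perturbation mechanism $M(x) = f(x) + Z$, $Z \sim \mathcal{N}(0,\sigma^2 I)$, with $\sigma = \Delta/(2\delta)$ is $(0,\delta)$-DP.
   Context: $\|\cdot\|$ is the Euclidean norm on $\mathbb{R}^d$, and $I$ is the $d\times d$ identity matrix. A randomized algorithm $M : \mathbb{X} \to \mathbb{Y}$ is $(\varepsilon,\delta)$-DP (differentially private) if for every pair of neighbouring inputs $x \simeq x'$ and every measurable set $E \subseteq \mathbb{Y}$ one has $\mathbb{P}[M(x) \in E] \leq e^{\varepsilon}\, \mathbb{P}[M(x') \in E] + \delta$. *)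

theory Defs
  imports "HOL-Probability.Probability"
begin

text \<open>
  The normal distribution on \<open>real ^ 'n\<close> with mean \<open>\<mu>\<close> and covariance matrix \<open>S\<close>, given by its
  Lebesgue density; this is meaningful only for symmetric positive definite \<open>S\<close>.
\<close>

definition multivariate_normal :: "real ^ 'n \<Rightarrow> real ^ 'n ^ 'n \<Rightarrow> (real ^ 'n) measure" where
  "multivariate_normal \<mu> S = density lborel (\<lambda>z. ennreal
     (exp (- ((z - \<mu>) \<bullet> (matrix_inv S *v (z - \<mu>))) / 2) / sqrt ((2 * pi) ^ CARD('n) * det S)))"

text \<open>
  A randomized algorithm is represented by the map sending each input to the law of its output.
  The condition \<open>M x \<in> space (prob_algebra Y)\<close> says that \<open>M x\<close> is a probability measure
  on the measurable space \<open>Y\<close>.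
\<close>

definition randomized_algorithm :: "'x set \<Rightarrow> 'y measure \<Rightarrow> ('x \<Rightarrow> 'y measure) \<Rightarrow> bool" where
  "randomized_algorithm X Y M \<longleftrightarrow> (\<forall>x\<in>X. M x \<in> space (prob_algebra Y))"

definition differentially_private ::
    "'x set \<Rightarrow> ('x \<Rightarrow> 'x \<Rightarrow> bool) \<Rightarrow> 'y measure \<Rightarrow> real \<Rightarrow> real \<Rightarrow> ('x \<Rightarrow> 'y measure) \<Rightarrow> bool" where
  "differentially_private X nb Y \<epsilon> \<delta> M \<longleftrightarrow>
     randomized_algorithm X Y M \<and>
     (\<forall>x\<in>X. \<forall>x'\<in>X. nb x x' \<longrightarrow>
        (\<forall>E\<in>sets Y. measure (M x) E \<le> exp \<epsilon> * measure (M x') E + \<delta>))"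

text \<open>The supremum is taken in \<open>ennreal\<close>, so that unbounded sensitivity is the value \<open>\<infinity>\<close>.\<close>

definition l2_sensitivity ::
    "'x set \<Rightarrow> ('x \<Rightarrow> 'x \<Rightarrow> bool) \<Rightarrow> ('x \<Rightarrow> 'a::real_normed_vector) \<Rightarrow> ennreal" where
  "l2_sensitivity X nb f =
     (SUP (x, x') \<in> {(x, x'). x \<in> X \<and> x' \<in> X \<and> nb x x'}. ennreal (norm (f x - f x')))"

definition gaussian_mechanism ::
    "('x \<Rightarrow> real ^ 'n) \<Rightarrow> real \<Rightarrow> 'x \<Rightarrow> (real ^ 'n) measure" where
  "gaussian_mechanism f \<sigma> x =
     distr (multivariate_normal 0 (\<sigma>\<^sup>2 *\<^sub>R mat 1)) borel (\<lambda>z. f x + z)"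

end

(*
  The total variation distance of two densities p, q is at most sqrt (1 - B^2), where
  B = \<integral> sqrt (p q) is their Bhattacharyya coefficient: factor
  \<bar>p - q\<bar> = \<bar>sqrt p - sqrt q\<bar> (sqrt p + sqrt q) and apply the Cauchy-Schwarz inequality.
  By the parallelogram law, the geometric mean of the densities of N(a, s^2 I) and N(b, s^2 I) is
  exp (- \<bar>a - b\<bar>^2 / (8 s^2)) times the density of N((a + b) / 2, s^2 I), so that
  1 - B^2 = 1 - exp (- \<bar>a - b\<bar>^2 / (4 s^2)) \<le> (\<bar>a - b\<bar> / (2 s))^2.
*)
theory Submission
  imports Defs
begin

section \<open>Total variation and the Bhattacharyya coefficient\<close>

text \<open>Pointwise form of Cauchy-Schwarz with a free weight \<open>t\<close>: integrating it and
  then optimising over \<open>t\<close> gives the Cauchy-Schwarz bound, using only monotonicity and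
  linearity of the integral.\<close>

lemma abs_diff_le_weighted_sqrt:
  fixes p q t :: real
  assumes "0 \<le> p" "0 \<le> q" "0 < t"
  shows "\<bar>p - q\<bar> \<le> t / 2 * (p + q - 2 * sqrt (p * q)) + 1 / (2 * t) * (p + q + 2 * sqrt (p * q))"
proof -
  define u v where "u = sqrt p" and "v = sqrt q"
  have uv: "p = u\<^sup>2" "q = v\<^sup>2" "0 \<le> u" "0 \<le> v"
    using assms by (auto simp: u_def v_def)
  have s: "sqrt (p * q) = u * v"
    unfolding u_def v_def real_sqrt_mult ..
  \<comment> \<open>AM-GM for the two factors \<open>t * \<bar>u - v\<bar>\<close> and
    \<open>u + v\<close>.\<close>
  have "0 \<le> (t * \<bar>u - v\<bar> - (u + v))\<^sup>2" by simp
  also have "\<dots> = t\<^sup>2 * (u - v)\<^sup>2 + (u + v)\<^sup>2 - 2 * t * (\<bar>u - v\<bar> * (u + v))"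
    by (simp add: power2_diff power_mult_distrib mult_ac)
  also have "\<bar>u - v\<bar> * (u + v) = \<bar>p - q\<bar>"
  proof -
    have "\<bar>u - v\<bar> * (u + v) = \<bar>(u - v) * (u + v)\<bar>"
      using uv by (simp add: abs_mult)
    also have "(u - v) * (u + v) = p - q"
      unfolding uv by (simp add: power2_eq_square algebra_simps)
    finally show ?thesis .
  qed
  finally have "2 * t * \<bar>p - q\<bar> \<le> t\<^sup>2 * (u - v)\<^sup>2 + (u + v)\<^sup>2" by simp
  then have "\<bar>p - q\<bar> \<le> (t\<^sup>2 * (u - v)\<^sup>2 + (u + v)\<^sup>2) / (2 * t)"
    using \<open>0 < t\<close> by (simp add: pos_le_divide_eq mult_ac)
  also have "\<dots> = t / 2 * (u - v)\<^sup>2 + 1 / (2 * t) * (u + v)\<^sup>2"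
    using \<open>0 < t\<close> by (simp add: field_simps power2_eq_square)
  also have "(u - v)\<^sup>2 = p + q - 2 * sqrt (p * q)"
    unfolding s unfolding uv by (simp add: power2_diff)
  also have "(u + v)\<^sup>2 = p + q + 2 * sqrt (p * q)"
    unfolding s unfolding uv by (simp add: power2_sum)
  finally show ?thesis .
qed

lemma set_integral_diff_le_bhattacharyya:
  fixes p q :: "'a \<Rightarrow> real"
  assumes p: "integrable M p" "\<And>x. 0 \<le> p x" "(\<integral>x. p x \<partial>M) = 1"
    and q: "integrable M q" "\<And>x. 0 \<le> q x" "(\<integral>x. q x \<partial>M) = 1"
    and r: "integrable M (\<lambda>x. sqrt (p x * q x))"
    and B: "(\<integral>x. sqrt (p x * q x) \<partial>M) = B" "0 \<le> B" "B < 1"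
    and E: "E \<in> sets M"
  shows "(\<integral>x. indicator E x * p x \<partial>M) - (\<integral>x. indicator E x * q x \<partial>M) \<le> sqrt (1 - B\<^sup>2)"
proof -
  have ip: "integrable M (\<lambda>x. indicator E x * p x)" and iq: "integrable M (\<lambda>x. indicator E x * q x)"
    using integrable_mult_indicator[OF E p(1)] integrable_mult_indicator[OF E q(1)] by simp_all
  \<comment> \<open>The integrated bound below is \<open>t * (1 - B) + (1 + B) / t\<close>. This
    \<open>t\<close> minimises it by making both summands equal to
    \<open>sqrt (1 - B\<^sup>2)\<close>; \<open>B < 1\<close> keeps the quotient meaningful.\<close>
  define t where "t = sqrt ((1 + B) / (1 - B))"
  have t: "0 < t" using B by (simp add: t_def)
  \<comment> \<open>Since \<open>p\<close> and \<open>q\<close> both integrate to 1, subtracting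
    \<open>p x - q x\<close> costs nothing. The integrand becomes \<open>p x - q x\<close> on
    \<open>E\<close> and its negative off \<open>E\<close>, hence at most
    \<open>\<bar>p x - q x\<bar>\<close>; this saves a factor 2.\<close>
  have "2 * ((\<integral>x. indicator E x * p x \<partial>M) - (\<integral>x. indicator E x * q x \<partial>M))
      = (\<integral>x. 2 * (indicator E x * p x - indicator E x * q x) - (p x - q x) \<partial>M)"
    using ip iq p q by simp
  also have "\<dots> \<le> (\<integral>x. t / 2 * (p x + q x - 2 * sqrt (p x * q x))
                      + 1 / (2 * t) * (p x + q x + 2 * sqrt (p x * q x)) \<partial>M)"
  proof (rule integral_mono)
    fix x
    have "2 * (indicator E x * p x - indicator E x * q x) - (p x - q x) \<le> \<bar>p x - q x\<bar>"
      by (auto simp: indicator_def)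
    also note abs_diff_le_weighted_sqrt[OF p(2)[of x] q(2)[of x] t]
    finally show "2 * (indicator E x * p x - indicator E x * q x) - (p x - q x)
      \<le> t / 2 * (p x + q x - 2 * sqrt (p x * q x))
         + 1 / (2 * t) * (p x + q x + 2 * sqrt (p x * q x))" .
  qed (use ip iq p q r in simp_all)
  also have "\<dots> = t * (1 - B) + (1 + B) / t"
    using p q r B t by (simp add: field_simps)
  also have "t * (1 - B) = sqrt (1 - B\<^sup>2)"
  proof -
    have "t * (1 - B) = sqrt ((1 + B) / (1 - B) * (1 - B)\<^sup>2)"
      unfolding t_def real_sqrt_mult using B by simp
    also have "(1 + B) / (1 - B) * (1 - B)\<^sup>2 = 1 - B\<^sup>2"
      using B by (simp add: field_simps power2_eq_square)
    finally show ?thesis .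
  qed
  also have "(1 + B) / t = sqrt (1 - B\<^sup>2)"
  proof -
    have "(1 + B) / t = sqrt ((1 + B)\<^sup>2 / ((1 + B) / (1 - B)))"
      unfolding t_def real_sqrt_divide using B by simp
    also have "(1 + B)\<^sup>2 / ((1 + B) / (1 - B)) = 1 - B\<^sup>2"
      using B by (simp add: field_simps power2_eq_square)
    finally show ?thesis .
  qed
  finally show ?thesis by simp
qed

section \<open>Isotropic Gaussian densities\<close>

text \<open>For \<open>s > 0\<close>, the density of N(a, s^2 I), written without matrices so that
  norm identities apply directly.\<close>

definition isotropic_density :: "real \<Rightarrow> 'a::euclidean_space \<Rightarrow> 'a \<Rightarrow> real" where
  "isotropic_density s a z = exp (- (norm (z - a))\<^sup>2 / (2 * s\<^sup>2)) / sqrt ((2 * pi * s\<^sup>2) ^ DIM('a))"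

lemma borel_measurable_isotropic_density [measurable]:
  "isotropic_density s a \<in> borel_measurable borel"
  unfolding isotropic_density_def by measurable

lemma isotropic_density_nonneg: "0 \<le> isotropic_density s a z"
  by (simp add: isotropic_density_def)

text \<open>The squared norm splits over the orthonormal basis. With Tonelli's theorem this reduces
  normalisation to the one-dimensional case.\<close>

lemma isotropic_density_eq_prod:
  fixes a z :: "'a::euclidean_space"
  shows "isotropic_density s a z = (\<Prod>b\<in>Basis. normal_density (a \<bullet> b) s (z \<bullet> b))"
proof -
  have "(norm (z - a))\<^sup>2 = (\<Sum>b\<in>Basis. (z \<bullet> b - a \<bullet> b)\<^sup>2)"
    unfolding power2_norm_eq_inner euclidean_inner[of "z - a" "z - a"]
    by (simp add: inner_diff_left power2_eq_square)
  then show ?thesis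
    by (simp add: isotropic_density_def normal_density_def prod_dividef exp_sum[symmetric]
        sum_divide_distrib sum_negf prod.distrib real_sqrt_power)
qed

lemma nn_integral_isotropic_density:
  fixes a :: "'a::euclidean_space"
  assumes "0 < s"
  shows "(\<integral>\<^sup>+z. ennreal (isotropic_density s a z) \<partial>lborel) = 1"
proof -
  have "(\<integral>\<^sup>+z. ennreal (isotropic_density s a z) \<partial>lborel)
      = (\<integral>\<^sup>+z. (\<Prod>b\<in>Basis. ennreal (normal_density (a \<bullet> b) s (z \<bullet> b))) \<partial>lborel)"
    by (simp add: isotropic_density_eq_prod prod_ennreal)
  also have "\<dots> = (\<Prod>b\<in>Basis. \<integral>\<^sup>+x. ennreal (normal_density (a \<bullet> b) s x) \<partial>lborel)"
    by (rule nn_integral_lborel_prod) auto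
  also have "\<dots> = 1"
    using assms
    by (simp add: nn_integral_eq_integral integrable_normal_density integral_normal_density)
  finally show ?thesis .
qed

lemma
  fixes a :: "'a::euclidean_space"
  assumes "0 < s"
  shows integrable_isotropic_density: "integrable lborel (isotropic_density s a)"
    and integral_isotropic_density: "(\<integral>z. isotropic_density s a z \<partial>lborel) = 1"
proof -
  have "has_bochner_integral lborel (isotropic_density s a) 1"
    by (rule has_bochner_integral_nn_integral)
      (auto simp: isotropic_density_nonneg nn_integral_isotropic_density assms)
  then show "integrable lborel (isotropic_density s a)"
    and "(\<integral>z. isotropic_density s a z \<partial>lborel) = 1"
    by (auto simp: has_bochner_integral_iff)
qed

lemma sqrt_mult_isotropic_density:
  fixes a b z :: "'a::euclidean_space"
  assumes "0 < s"
  shows "sqrt (isotropic_density s a z * isotropic_density s b z)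
    = exp (- (norm (a - b))\<^sup>2 / (8 * s\<^sup>2)) * isotropic_density s ((1 / 2) *\<^sub>R (a + b)) z"
proof -
  define m where "m = (1 / 2) *\<^sub>R (a + b)"
  define c where "c = sqrt ((2 * pi * s\<^sup>2) ^ DIM('a))"
  have c: "0 < c" using assms by (simp add: c_def)
  \<comment> \<open>Parallelogram law for \<open>z - a\<close> and \<open>z - b\<close>, whose sum
    is \<open>2 *\<^sub>R (z - m)\<close> and whose difference has norm
    \<open>norm (a - b)\<close>.\<close>
  have par: "(norm (z - a))\<^sup>2 + (norm (z - b))\<^sup>2 = 2 * (norm (z - m))\<^sup>2 + (norm (a - b))\<^sup>2 / 2"
    by (simp add: m_def power2_norm_eq_inner inner_diff_left inner_diff_right inner_add_left
        inner_add_right inner_commute algebra_simps)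
      (simp add: field_simps)
  have "isotropic_density s a z * isotropic_density s b z
      = exp (- ((norm (z - a))\<^sup>2 + (norm (z - b))\<^sup>2) / (2 * s\<^sup>2)) / c\<^sup>2"
    unfolding isotropic_density_def c_def[symmetric]
    by (simp add: exp_add[symmetric] power2_eq_square add_divide_distrib diff_divide_distrib)
  \<comment> \<open>The factor 2 is pulled out so that the product of densities becomes a perfect
    square, whose root can be read off.\<close>
  also have "- ((norm (z - a))\<^sup>2 + (norm (z - b))\<^sup>2) / (2 * s\<^sup>2)
      = 2 * (- (norm (a - b))\<^sup>2 / (8 * s\<^sup>2) + - (norm (z - m))\<^sup>2 / (2 * s\<^sup>2))"
    unfolding par using assms by (simp add: field_simps)
  also have "exp \<dots> / c\<^sup>2 = (exp (- (norm (a - b))\<^sup>2 / (8 * s\<^sup>2)) * isotropic_density s m z)\<^sup>2"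
    unfolding isotropic_density_def c_def[symmetric] exp_double exp_add
    by (simp add: power_divide power_mult_distrib)
  finally show ?thesis
    by (simp add: m_def isotropic_density_nonneg)
qed

section \<open>Total variation between translated Gaussians\<close>

lemma measure_density_isotropic_density:
  fixes a :: "'a::euclidean_space"
  assumes "0 < s" "E \<in> sets borel"
  shows "measure (density lborel (\<lambda>z. ennreal (isotropic_density s a z))) E
    = (\<integral>z. indicator E z * isotropic_density s a z \<partial>lborel)"
proof -
  have "emeasure (density lborel (\<lambda>z. ennreal (isotropic_density s a z))) E
      = (\<integral>\<^sup>+z. ennreal (indicator E z * isotropic_density s a z) \<partial>lborel)"
    using assms(2)
    by (subst emeasure_density) (auto intro!: nn_integral_cong simp: indicator_def)
  also have "\<dots> = ennreal (\<integral>z. indicator E z * isotropic_density s a z \<partial>lborel)"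
    using integrable_mult_indicator[OF _ integrable_isotropic_density[OF assms(1), of a], of E] assms(2)
    by (intro nn_integral_eq_integral) (auto simp: isotropic_density_nonneg)
  finally show ?thesis
    by (simp add: measure_def isotropic_density_nonneg)
qed

lemma measure_isotropic_diff_le:
  fixes a b :: "'a::euclidean_space"
  assumes s: "0 < s" and E: "E \<in> sets borel"
  shows "measure (density lborel (\<lambda>z. ennreal (isotropic_density s a z))) E
    - measure (density lborel (\<lambda>z. ennreal (isotropic_density s b z))) E \<le> norm (a - b) / (2 * s)"
proof (cases "a = b")
  case False
  \<comment> \<open>The geometric mean of the densities is \<open>B\<close> times the density
    centred at the midpoint, which integrates to 1, so \<open>B\<close> is their Bhattacharyya
    coefficient; \<open>a \<noteq> b\<close> makes it less than 1.\<close>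
  define B where "B = exp (- (norm (a - b))\<^sup>2 / (8 * s\<^sup>2))"
  have "(\<integral>z. indicator E z * isotropic_density s a z \<partial>lborel)
      - (\<integral>z. indicator E z * isotropic_density s b z \<partial>lborel) \<le> sqrt (1 - B\<^sup>2)"
    using s False E
    by (intro set_integral_diff_le_bhattacharyya)
      (simp_all add: integrable_isotropic_density integral_isotropic_density
        isotropic_density_nonneg sqrt_mult_isotropic_density B_def)
  also have "\<dots> \<le> sqrt ((norm (a - b) / (2 * s))\<^sup>2)"
  proof (rule real_sqrt_le_mono)
    have "B\<^sup>2 = exp (- (norm (a - b) / (2 * s))\<^sup>2)"
      unfolding B_def exp_double[symmetric] by (simp add: power_divide power_mult_distrib)
    \<comment> \<open>This is \<open>1 - exp (- y) \<le> y\<close> at the square of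
      \<open>norm (a - b) / (2 * s)\<close>.\<close>
    then show "1 - B\<^sup>2 \<le> (norm (a - b) / (2 * s))\<^sup>2"
      using exp_ge_add_one_self[of "- (norm (a - b) / (2 * s))\<^sup>2"] by simp
  qed
  also have "\<dots> = norm (a - b) / (2 * s)"
    using s by simp
  finally show ?thesis
    by (simp add: measure_density_isotropic_density s E)
qed simp

section \<open>The law of the Gaussian mechanism\<close>

lemma matrix_inv_scaleR_mat:
  fixes c :: real
  assumes "c \<noteq> 0"
  shows "matrix_inv (c *\<^sub>R mat 1 :: real ^ 'n ^ 'n) = (1 / c) *\<^sub>R mat 1"
proof -
  let ?A = "c *\<^sub>R mat 1 :: real ^ 'n ^ 'n"
  have "invertible ?A"
    unfolding invertible_def using assms
    by (intro exI[of _ "(1 / c) *\<^sub>R mat 1"])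
      (simp add: scalar_matrix_assoc[symmetric] matrix_scalar_ac)
  \<comment> \<open>\<open>matrix_inv\<close> is defined by Hilbert choice, so its defining equation
    becomes available only through invertibility.\<close>
  then have "?A ** matrix_inv ?A = mat 1"
    unfolding invertible_def matrix_inv_def by (rule someI2_ex) simp
  then have "c *\<^sub>R matrix_inv ?A = mat 1"
    by (simp add: scalar_matrix_assoc[symmetric])
  then show ?thesis
    using assms by (simp add: divideR_right flip: inverse_eq_divide)
qed

lemma multivariate_normal_isotropic:
  assumes "0 < s"
  shows "multivariate_normal \<mu> (s\<^sup>2 *\<^sub>R mat 1 :: real ^ 'n ^ 'n)
    = density lborel (\<lambda>z. ennreal (isotropic_density s \<mu> z))"
proof -
  have d: "det (s\<^sup>2 *\<^sub>R mat 1 :: real ^ 'n ^ 'n) = (s\<^sup>2) ^ CARD('n)"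
    by (subst det_diagonal) (simp_all add: mat_def)
  show ?thesis
    using assms unfolding multivariate_normal_def isotropic_density_def
    by (simp add: d matrix_inv_scaleR_mat scaleR_matrix_vector_assoc[symmetric]
        power_mult_distrib power2_norm_eq_inner mult.commute)
qed

text \<open>Lebesgue measure is invariant under translation by \<open>f x\<close>, and pulling the
  density centred at \<open>f x\<close> back along that translation gives the centred one.\<close>

lemma gaussian_mechanism_eq_density:
  assumes "0 < s"
  shows "gaussian_mechanism f s x = density lborel (\<lambda>z. ennreal (isotropic_density s (f x) z))"
proof -
  have "density lborel (\<lambda>z. ennreal (isotropic_density s (f x) z))
      = density (distr lborel borel ((+) (f x))) (\<lambda>z. ennreal (isotropic_density s (f x) z))"
    by (simp add: lborel_distr_plus)
  also have "\<dots> = distr (density lborel (\<lambda>z. ennreal (isotropic_density s (f x) (f x + z)))) borel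
                    ((+) (f x))"
    by (subst density_distr) auto
  also have "(\<lambda>z. isotropic_density s (f x) (f x + z)) = isotropic_density s 0"
    by (auto simp: isotropic_density_def)
  finally show ?thesis
    by (simp add: gaussian_mechanism_def multivariate_normal_isotropic assms)
qed

section \<open>From sensitivity to privacy\<close>

lemma norm_diff_le_l2_sensitivity:
  assumes "l2_sensitivity X nb f = ennreal \<Delta>" "0 \<le> \<Delta>" "x \<in> X" "x' \<in> X" "nb x x'"
  shows "norm (f x - f x') \<le> \<Delta>"
proof -
  have "ennreal (norm (f x - f x')) \<le> l2_sensitivity X nb f"
    unfolding l2_sensitivity_def using assms(3-5) by (intro SUP_upper2[of "(x, x')"]) auto
  then show ?thesis
    using assms(1,2) by simp
qed

theorem theorem2:
  fixes X :: "'x set"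
    and nb :: "'x \<Rightarrow> 'x \<Rightarrow> bool"
    and f :: "'x \<Rightarrow> real ^ 'n"
    and \<Delta> \<delta> \<sigma> :: real
  assumes "symp_on X nb"
    and "l2_sensitivity X nb f = ennreal \<Delta>"
    and "0 < \<Delta>"
    and "0 < \<delta>" and "\<delta> \<le> 1"
    and "\<sigma> = \<Delta> / (2 * \<delta>)"
  shows "differentially_private X nb borel 0 \<delta> (gaussian_mechanism f \<sigma>)"
proof -
  have s: "0 < \<sigma>" using assms by simp
  show ?thesis
    unfolding differentially_private_def randomized_algorithm_def
  proof (intro conjI ballI impI)
    fix x
    show "gaussian_mechanism f \<sigma> x \<in> space (prob_algebra borel)"
      unfolding gaussian_mechanism_eq_density[OF s] space_prob_algebra
      by (auto intro!: prob_spaceI simp: emeasure_density nn_integral_isotropic_density[OF s])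
  next
    fix x x' and E :: "(real ^ 'n) set"
    assume x: "x \<in> X" "x' \<in> X" "nb x x'" and E: "E \<in> sets borel"
    \<comment> \<open>With privacy parameter 0 the factor \<open>exp 0\<close> is 1, so the claim is
      a bound on the difference of the two probabilities.\<close>
    have "measure (gaussian_mechanism f \<sigma> x) E - measure (gaussian_mechanism f \<sigma> x') E
        \<le> norm (f x - f x') / (2 * \<sigma>)"
      unfolding gaussian_mechanism_eq_density[OF s] by (rule measure_isotropic_diff_le[OF s E])
    also have "\<dots> \<le> \<Delta> / (2 * \<sigma>)"
      using norm_diff_le_l2_sensitivity[OF assms(2) _ x] assms(3) s by (simp add: divide_right_mono)
    \<comment> \<open>The noise scale \<open>\<sigma> = \<Delta> / (2 * \<delta>)\<close> is the one
      that makes this an equality.\<close>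
    also have "\<dots> = \<delta>"
      using assms by simp
    finally show "measure (gaussian_mechanism f \<sigma> x) E
        \<le> exp 0 * measure (gaussian_mechanism f \<sigma> x') E + \<delta>"
      by simp
  qed
qed

end
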